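(* Let $a,b:\mathbb{N}\to\mathbb{R}$ be sequences such that both $\sum_{n=0}^\infty(|a_n|+|b_n|)$ and $\sum_{n=0}^\infty n(|a_n|+|b_n|)$ converge. Let $$F(x)=\tfrac12a_0+\sum_{n=1}^\infty\bigl(a_n\cos(nx)+b_n\sin(nx)\bigr),\qquad x\in\mathbb{R}.$$ Then $F$ is differentiable at every $x\in\mathbb{R}$ and $$F'(x)=\sum_{n=1}^\infty\bigl(-na_n\sin(nx)+nb_n\cos(nx)\bigr).$$
   Context: The sequences $a,b$ are arbitrary real sequences indexed by $\mathbb{N}=\{0,1,2,\dots\}$; they are not assumed to be the Fourier coefficients of a given function. *)

theory Defs
  imports "HOL-Analysis.Analysis"
begin

text \<open>The series starts at index 1, hence the shift by \<^const>\<open>Suc\<close>. Since \<^const>\<open>suminf\<close>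
  is only meaningful for convergent series, convergence has to be stated separately.\<close>

definition trig_term :: "(nat \<Rightarrow> real) \<Rightarrow> (nat \<Rightarrow> real) \<Rightarrow> real \<Rightarrow> nat \<Rightarrow> real" where
  "trig_term a b x n = a n * cos (real n * x) + b n * sin (real n * x)"

definition trig_series :: "(nat \<Rightarrow> real) \<Rightarrow> (nat \<Rightarrow> real) \<Rightarrow> real \<Rightarrow> real" where
  "trig_series a b x = a 0 / 2 + (\<Sum>n. trig_term a b x (Suc n))"

definition trig_deriv_term :: "(nat \<Rightarrow> real) \<Rightarrow> (nat \<Rightarrow> real) \<Rightarrow> real \<Rightarrow> nat \<Rightarrow> real" where
  "trig_deriv_term a b x n = - real n * a n * sin (real n * x) + real n * b n * cos (real n * x)"

end

theory Submission
  imports Defs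
begin

text \<open>Since sine and cosine are bounded by 1, the derivative of the \<open>n\<close>-th term is at most
  \<open>n (\<bar>a\<^sub>n\<bar> + \<bar>b\<^sub>n\<bar>)\<close> for every \<open>x\<close> (\<open>abs_trig_deriv_term_le\<close>). By the second hypothesis and the
  Weierstrass M-test, the differentiated series converges uniformly on the whole line. A series of
  differentiable functions that converges at one point and whose derivatives converge uniformly
  may be differentiated term by term (\<open>has_field_derivative_series'\<close>); the first hypothesis gives
  the pointwise convergence by comparison (\<open>abs_trig_term_le\<close>).\<close>

lemma abs_trig_term_le: "\<bar>trig_term a b x n\<bar> \<le> \<bar>a n\<bar> + \<bar>b n\<bar>"
proof -
  have "\<bar>a n * cos (real n * x)\<bar> \<le> \<bar>a n\<bar>" "\<bar>b n * sin (real n * x)\<bar> \<le> \<bar>b n\<bar>"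
    by (simp_all add: abs_mult mult_left_le)
  then show ?thesis
    unfolding trig_term_def by linarith
qed

text \<open>Differentiation scales the coefficients by \<open>n\<close>, swaps their roles and changes one sign;
  bounds for \<^const>\<open>trig_term\<close> therefore carry over to \<^const>\<open>trig_deriv_term\<close>.\<close>

lemma trig_deriv_term_eq_trig_term:
  "trig_deriv_term a b x n = trig_term (\<lambda>n. real n * b n) (\<lambda>n. - (real n * a n)) x n"
  by (simp add: trig_deriv_term_def trig_term_def)

lemma abs_trig_deriv_term_le: "\<bar>trig_deriv_term a b x n\<bar> \<le> real n * (\<bar>a n\<bar> + \<bar>b n\<bar>)"
  using abs_trig_term_le[of "\<lambda>n. real n * b n" "\<lambda>n. - (real n * a n)" x n]
  by (simp add: trig_deriv_term_eq_trig_term abs_mult algebra_simps)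

lemma has_real_derivative_trig_term:
  "((\<lambda>x. trig_term a b x n) has_real_derivative trig_deriv_term a b x n) (at x within S)"
  unfolding trig_term_def trig_deriv_term_def
  by (auto intro!: derivative_eq_intros simp: algebra_simps)

theorem theorem3p8:
  fixes a b :: "nat \<Rightarrow> real"
  assumes "summable (\<lambda>n. \<bar>a n\<bar> + \<bar>b n\<bar>)"
    and "summable (\<lambda>n. real n * (\<bar>a n\<bar> + \<bar>b n\<bar>))"
  shows "\<forall>x. summable (\<lambda>n. trig_term a b x (Suc n))
           \<and> summable (\<lambda>n. trig_deriv_term a b x (Suc n))
           \<and> (trig_series a b has_real_derivative (\<Sum>n. trig_deriv_term a b x (Suc n))) (at x)"
proof (intro allI conjI)
  fix x :: real
  have coeffs: "summable (\<lambda>n. \<bar>a (Suc n)\<bar> + \<bar>b (Suc n)\<bar>)"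
    using assms(1) by (subst summable_Suc_iff)
  have weighted: "summable (\<lambda>n. real (Suc n) * (\<bar>a (Suc n)\<bar> + \<bar>b (Suc n)\<bar>))"
    using assms(2) by (subst summable_Suc_iff)
  show conv: "summable (\<lambda>n. trig_term a b x (Suc n))"
    by (rule summable_comparison_test'[OF coeffs]) (use abs_trig_term_le in auto)
  show "summable (\<lambda>n. trig_deriv_term a b x (Suc n))"
    by (rule summable_comparison_test'[OF weighted])
       (use abs_trig_deriv_term_le in \<open>simp only: real_norm_def\<close>)
  have "uniformly_convergent_on UNIV (\<lambda>N x. \<Sum>n<N. trig_deriv_term a b x (Suc n))"
    by (rule Weierstrass_m_test'[OF _ weighted])
       (use abs_trig_deriv_term_le in \<open>simp only: real_norm_def\<close>)
  then have "((\<lambda>x. \<Sum>n. trig_term a b x (Suc n)) has_real_derivative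
      (\<Sum>n. trig_deriv_term a b x (Suc n))) (at x)"
    using conv
    by (intro has_field_derivative_series'(2)[where S = UNIV and ?x0.0 = x])
       (auto intro: has_real_derivative_trig_term)
  from DERIV_add[OF DERIV_const this]
  show "(trig_series a b has_real_derivative (\<Sum>n. trig_deriv_term a b x (Suc n))) (at x)"
    by (simp add: trig_series_def[abs_def])
qed

end
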